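(* Let $K$ be a field of characteristic $0$. (1) For all $G(x,y)\in K[[x,y]]$, the number of positive roots (counted with multiplicity) of $G(x,y)$ that lie in $K^{\mathrm{fra}}[[x]]$ equals the order of $G(0,y)$ (the least exponent of $y$ occurring in $G(0,y)$). (2) For all $G(x,y)\in K[y][[x]]$, the number of roots (counted with multiplicity) of $G(x,y)$ that lie in $K^{\mathrm{fra}}[[x]]$ and have constant term $\alpha$ equals the multiplicity of $\alpha$ as a root of $G(0,y)$.
   Context: $K^{\mathrm{fra}}[[x]]=\bigcup_{N\ge1}K[[x^{1/N}]]$ is the ring of fractional power series. A root of $G(x,y)$ is a $Y=Y(x)$ with $G(x,Y(x))=0$; a positive root is a root $Y\in K^{\mathrm{fra}}[[x]]$ with zero constant term $Y(0)=0$ (for which the substitution is defined for every $G\in K[[x,y]]$; for $G\in K[y][[x]]$, the ring of power series in $x$ with coefficients in $K[y]$, substitution of any $Y\in K^{\mathrm{fra}}[[x]]$ is defined). The multiplicity of a positive root $Y$ of $G$ is the exponent of $y-Y$ in the factorization of $G$, i.e. the largest $k$ such that $G(x,y)=(y-Y)^kF(x,y)$ for some $N\ge1$ and some $F\in K[[x^{1/N},y]]$. The multiplicity of a root $Y$ with constant term $\alpha\in K$ of $G\in K[y][[x]]$ is the multiplicity of the positive root $Y-\alpha$ of $G(x,y+\alpha)$.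
   Formalization: K is additionally assumed algebraically closed (over K = Q, y^2 - 2x^2 has order 2 at x = 0 but no root in K^fra[[x]]), and G(0,y) is assumed nonzero, so that its order and the multiplicity of α as a root of it are defined. *)

theory Defs
  imports "HOL-Computational_Algebra.Computational_Algebra" "HOL-Library.Extended_Nat"
begin

text \<open>
  A fractional power series is represented by its coefficient function on rational exponents.
  \<open>fra_ps N F\<close> is the series $F(x^{1/N})$; for \<open>N \<ge> 1\<close> the map \<open>fra_ps N\<close> is injective, with
  image $K[[x^{1/N}]]$.
\<close>

definition fra_ps :: "nat \<Rightarrow> 'a::zero fps \<Rightarrow> rat \<Rightarrow> 'a" where
  "fra_ps N F = (\<lambda>q. if q * of_nat N \<in> \<nat> then fps_nth F (nat \<lfloor>q * of_nat N\<rfloor>) else 0)"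

definition fra_set :: "(rat \<Rightarrow> 'a::zero) set" where
  "fra_set = (\<Union>N\<in>{1..}. range (fra_ps N))"

text \<open>
  In \<open>'a fps fps\<close> (for $K[[x,y]]$) and \<open>'a poly fps\<close> (for $K[y][[x]]$) the outer series variable
  is $x$ and the inner variable is $y$, so \<open>fps_nth G 0\<close> is $G(0,y)$.

  Statements about $G$ and $Y(x) = F(x^{1/N})$ are made in the variable $t = x^{1/N}$:
  \<open>ramify N G\<close> is $G(t^N,y)$, and $Y$ becomes $F(t)$.
\<close>

definition ramify :: "nat \<Rightarrow> 'a::comm_ring_1 fps \<Rightarrow> 'a fps" where
  "ramify N G = fps_compose G (fps_X ^ N)"

text \<open>
  Substitution $y := F(t)$ in $H = \sum_n t^n H_n(y)$, as the convergent series
  $\sum_n t^n H_n(F(t))$ in $K[[t]]$ (with the $t$-adic topology of type \<open>fps\<close>). For $H \in K[[t,y]]$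
  it is meaningful only if $F(0) = 0$.
\<close>

definition subst_fps :: "'a::comm_ring_1 fps fps \<Rightarrow> 'a fps \<Rightarrow> 'a fps" where
  "subst_fps H F = (\<Sum>n. fps_X ^ n * fps_compose (fps_nth H n) F)"

definition subst_poly :: "'a::comm_ring_1 poly fps \<Rightarrow> 'a fps \<Rightarrow> 'a fps" where
  "subst_poly H F = (\<Sum>n. fps_X ^ n * poly (map_poly fps_const (fps_nth H n)) F)"

lemma sums_fps_X_power_mult:
  fixes c :: "nat \<Rightarrow> 'a::comm_ring_1 fps"
  shows "(\<lambda>n. fps_X ^ n * c n) sums Abs_fps (\<lambda>m. \<Sum>n\<le>m. fps_nth (c n) (m - n))"
  unfolding sums_def
proof (rule tendsto_fpsI)
  fix m
  have "fps_nth (\<Sum>n<k. fps_X ^ n * c n) m = (\<Sum>n\<le>m. fps_nth (c n) (m - n))" if "k > m" for k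
  proof -
    have "fps_nth (\<Sum>n<k. fps_X ^ n * c n) m
        = (\<Sum>n<k. if m < n then 0 else fps_nth (c n) (m - n))"
      by (simp add: fps_sum_nth fps_X_power_mult_nth)
    also have "\<dots> = (\<Sum>n\<le>m. fps_nth (c n) (m - n))"
      using that by (intro sum.mono_neutral_cong_right) auto
    finally show ?thesis .
  qed
  then show "\<forall>\<^sub>F k in sequentially. fps_nth (\<Sum>n<k. fps_X ^ n * c n) m
      = fps_nth (Abs_fps (\<lambda>m. \<Sum>n\<le>m. fps_nth (c n) (m - n))) m"
    by (intro eventually_mono[OF eventually_gt_at_top[of m]]) simp
qed

text \<open>
  Since $K[[x^{1/N}]]$ embeds into $K[[x^{1/(NM)}]]$, whether $G(x,Y(x)) = 0$ does not depend on
  the choice of $N$.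
\<close>

definition positive_roots :: "'a::comm_ring_1 fps fps \<Rightarrow> (rat \<Rightarrow> 'a) set" where
  "positive_roots G = {Y \<in> fra_set. Y 0 = 0 \<and>
     (\<exists>N\<ge>1. \<exists>F. Y = fra_ps N F \<and> subst_fps (ramify N G) F = 0)}"

definition roots_with_constant :: "'a::comm_ring_1 \<Rightarrow> 'a poly fps \<Rightarrow> (rat \<Rightarrow> 'a) set" where
  "roots_with_constant \<alpha> G = {Y \<in> fra_set. Y 0 = \<alpha> \<and>
     (\<exists>N\<ge>1. \<exists>F. Y = fra_ps N F \<and> subst_poly (ramify N G) F = 0)}"

text \<open>
  \<open>y_minus F\<close> is $y - F(t)$ in $K[[t,y]]$.
\<close>

definition y_minus :: "'a::comm_ring_1 fps \<Rightarrow> 'a fps fps" where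
  "y_minus F = fps_const fps_X - Abs_fps (\<lambda>n. fps_const (fps_nth F n))"

text \<open>
  The multiplicity is the largest admissible $k$, or \<open>\<infinity>\<close> if there are arbitrarily large ones.
  A common $N$ for $Y$ and the cofactor is no restriction: replace both denominators by a common
  multiple.
\<close>

definition positive_root_mult :: "'a::comm_ring_1 fps fps \<Rightarrow> (rat \<Rightarrow> 'a) \<Rightarrow> enat" where
  "positive_root_mult G Y = Sup {enat k | k. \<exists>N\<ge>1. \<exists>F H.
     Y = fra_ps N F \<and> ramify N G = y_minus F ^ k * H}"

text \<open>
  \<open>shift_y \<alpha> G\<close> is $G(x, y + \alpha)$, regarded as an element of $K[[x,y]]$.
\<close>

definition shift_y :: "'a::comm_ring_1 \<Rightarrow> 'a poly fps \<Rightarrow> 'a fps fps" where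
  "shift_y \<alpha> G = Abs_fps (\<lambda>n. fps_of_poly (pcompose (fps_nth G n) [:\<alpha>, 1:]))"

definition root_mult :: "'a::comm_ring_1 poly fps \<Rightarrow> (rat \<Rightarrow> 'a) \<Rightarrow> enat" where
  "root_mult G Y = positive_root_mult (shift_y (Y 0) G) (\<lambda>q. Y q - (if q = 0 then Y 0 else 0))"

end

theory Submission
  imports Defs
begin

text \<open>
  A series $G$ whose $G(0,y)$ has order $m$ is, up to a unit, a monic Weierstrass polynomial of degree
  $m$ in $y$ over $K[[x]]$. By the Newton--Puiseux argument it has a root $F(x^{1/N})$, which is
  positive; Weierstrass division by $y - F(t)$ splits off a linear factor of $G(t^N,y)$ and lowers $m$ by one.
  Iterating, $G(t^N, y) = \prod_{i=1}^m (y - F_i(t)) \cdot \mathrm{unit}$, and as $K[[t,y]]$ is a domain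
  in which $y - F_i$ generates the kernel of $y \mapsto F_i$, the positive roots and their
  multiplicities can be read off. The second part is the first one for $G(x, y + \alpha)$.
\<close>

section \<open>Ramification and substitution\<close>

text \<open>The root is not built term by term; the Newton--Puiseux argument is an induction on the
  degree. Its obstacle is a polynomial equal to (y - \<beta>)^m at t = 0, for which passing to
  \<beta> gains nothing. Making the coefficient of y^(m-1) vanish, which takes division by m and
  hence characteristic 0, leaves only the case \<beta> = 0, and the Newton polygon excludes that
  one. So some \<beta> has order strictly between 0 and m, and Weierstrass preparation at \<beta>
  takes the place of Hensel's lemma: what belongs to the other roots goes into the unit. If G(0,y) =
  0, there is no finite order to compare with, so this case is excluded throughout.\<close>

lemma ramify_nth:
  assumes "N \<ge> 1"
  shows "fps_nth (ramify N G) n = (if N dvd n then fps_nth G (n div N) else 0)"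
  unfolding ramify_def by (rule fps_nth_compose_X_power)

lemma ramify_0 [simp]: "ramify N 0 = 0"
  and ramify_1 [simp]: "ramify N 1 = 1"
  and ramify_const [simp]: "ramify N (fps_const c) = fps_const c"
  by (simp_all add: ramify_def)

lemma ramify_add: "ramify N (f + g) = ramify N f + ramify N g"
  by (simp add: ramify_def fps_compose_add_distrib)

lemma ramify_diff: "ramify N (f - g) = ramify N f - ramify N g"
  by (simp add: ramify_def fps_compose_sub_distrib)

lemma ramify_mult:
  fixes f g :: "'a::idom fps"
  assumes "N \<ge> 1"
  shows "ramify N (f * g) = ramify N f * ramify N g"
  using assms by (simp add: ramify_def fps_compose_mult_distrib)

lemma ramify_nth_0 [simp]: "N \<ge> 1 \<Longrightarrow> fps_nth (ramify N f) 0 = fps_nth f 0"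
  by (simp add: ramify_nth)

lemma ramify_one [simp]: "ramify 1 G = G"
  by (simp add: fps_eq_iff ramify_nth)

lemma ramify_ramify:
  assumes "N \<ge> 1" "M \<ge> 1"
  shows "ramify M (ramify N G) = ramify (N * M) G"
proof (rule fps_ext)
  fix n
  have "N * M dvd n \<longleftrightarrow> M dvd n \<and> N dvd n div M"
    using assms by (metis dvd_div_iff_mult dvd_mult_right not_one_le_zero)
  then show "fps_nth (ramify M (ramify N G)) n = fps_nth (ramify (N * M) G) n"
    using assms by (simp add: ramify_nth div_mult2_eq mult.commute[of N])
qed

text \<open>
  \<open>collapse\<close> identifies the inner with the outer variable, $C(x,y) \mapsto C(x,x)$. Substitution
  of $F$ is composition of every coefficient with $F$, followed by \<open>collapse\<close>.
\<close>

definition collapse :: "'a::comm_ring_1 fps fps \<Rightarrow> 'a fps" where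
  "collapse C = Abs_fps (\<lambda>m. \<Sum>n\<le>m. fps_nth (fps_nth C n) (m - n))"

lemma collapse_add: "collapse (C + D) = collapse C + collapse D"
  by (simp add: collapse_def fps_eq_iff sum.distrib)

text \<open>Splitting off the x-constant term leaves a factor \<open>fps_X\<close>, so identities
  for \<open>collapse\<close> follow by induction on the coefficient index instead of by rearranging
  double sums.\<close>

lemma collapse_rec: "collapse C = fps_nth C 0 + fps_X * collapse (fps_shift 1 C)"
proof (rule fps_ext)
  fix m show "fps_nth (collapse C) m = fps_nth (fps_nth C 0 + fps_X * collapse (fps_shift 1 C)) m"
    by (cases m) (simp_all add: collapse_def sum.atMost_Suc_shift del: sum.atMost_Suc)
qed

lemma collapse_const_mult: "collapse (fps_const c * D) = c * collapse D"
proof (rule fps_ext)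
  fix m show "fps_nth (collapse (fps_const c * D)) m = fps_nth (c * collapse D) m"
  proof (induction m arbitrary: D rule: less_induct)
    case (less m)
    have "collapse (fps_const c * D) = c * fps_nth D 0 + fps_X * collapse (fps_const c * fps_shift 1 D)"
    proof -
      have "fps_shift 1 (fps_const c * D) = fps_const c * fps_shift 1 D"
        by (rule fps_ext) simp
      then show ?thesis by (subst collapse_rec) simp
    qed
    moreover have "c * collapse D = c * fps_nth D 0 + fps_X * (c * collapse (fps_shift 1 D))"
      by (subst collapse_rec) (simp add: algebra_simps)
    ultimately show ?case using less.IH[of "m - 1" "fps_shift 1 D"] by (cases m) auto
  qed
qed

lemma collapse_X_mult: "collapse (fps_X * C) = fps_X * collapse C"
proof -
  have "fps_shift 1 (fps_X * C) = C"
    by (rule fps_ext) simp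
  then show ?thesis by (subst collapse_rec) simp
qed

lemma collapse_mult: "collapse (C * D) = collapse C * collapse D"
proof (rule fps_ext)
  fix m show "fps_nth (collapse (C * D)) m = fps_nth (collapse C * collapse D) m"
  proof (induction m arbitrary: C rule: less_induct)
    case (less m)
    have "C = fps_const (fps_nth C 0) + fps_X * fps_shift 1 C"
      by (rule fps_ext) simp
    then have "C * D = fps_const (fps_nth C 0) * D + fps_X * (fps_shift 1 C * D)"
      by (metis distrib_right mult.assoc)
    then have "collapse (C * D)
        = fps_nth C 0 * collapse D + fps_X * collapse (fps_shift 1 C * D)"
      by (simp add: collapse_add collapse_const_mult collapse_X_mult)
    moreover have "collapse C * collapse D
        = fps_nth C 0 * collapse D + fps_X * (collapse (fps_shift 1 C) * collapse D)"
      by (subst collapse_rec) (simp add: algebra_simps)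
    ultimately show ?case using less.IH[of "m - 1" "fps_shift 1 C"] by (cases m) auto
  qed
qed

lemma subst_fps_collapse: "subst_fps H F = collapse (Abs_fps (\<lambda>n. fps_compose (fps_nth H n) F))"
  unfolding subst_fps_def collapse_def
  using sums_fps_X_power_mult[of "\<lambda>n. fps_compose (fps_nth H n) F"] by (simp add: sums_iff)

lemma subst_poly_collapse:
  "subst_poly H F = collapse (Abs_fps (\<lambda>n. poly (map_poly fps_const (fps_nth H n)) F))"
  unfolding subst_poly_def collapse_def
  using sums_fps_X_power_mult[of "\<lambda>n. poly (map_poly fps_const (fps_nth H n)) F"]
  by (simp add: sums_iff)

lemma subst_fps_add: "subst_fps (G + H) F = subst_fps G F + subst_fps H F"
  unfolding subst_fps_collapse collapse_add [symmetric]
  by (rule arg_cong[of _ _ collapse]) (simp add: fps_eq_iff fps_compose_add_distrib)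

lemma subst_fps_diff: "subst_fps (G - H) F = subst_fps G F - subst_fps H F"
  using subst_fps_add[of "G - H" H F] by (simp add: algebra_simps)

text \<open>\<open>fps_compose\<close> is additive for every F, but multiplicative only if F has
  zero constant term; hence the hypothesis.\<close>

lemma subst_fps_mult:
  fixes F :: "'a::idom fps"
  assumes "fps_nth F 0 = 0"
  shows "subst_fps (G * H) F = subst_fps G F * subst_fps H F"
  unfolding subst_fps_collapse collapse_mult [symmetric]
  by (rule arg_cong[of _ _ collapse])
    (simp add: fps_eq_iff[where ?'a="'a fps"] fps_mult_nth fps_compose_sum_distrib
      fps_compose_mult_distrib[OF assms])

text \<open>Makes units harmless: if U has nonzero constant term, then so has its value at F, which
  can be cancelled in a domain.\<close>

lemma subst_fps_nth_0: "fps_nth (subst_fps G F) 0 = fps_nth (fps_nth G 0) 0"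
  by (simp add: subst_fps_collapse collapse_def)

text \<open>The counterpart of \<open>fps_const\<close>, which embeds the series in the inner
  variable y.\<close>

definition fps_in_x :: "'a::zero fps \<Rightarrow> 'a fps fps" where
  "fps_in_x f = Abs_fps (\<lambda>n. fps_const (fps_nth f n))"

lemma y_minus_eq: "y_minus F = fps_const fps_X - fps_in_x F"
  by (simp add: y_minus_def fps_in_x_def)

lemma subst_fps_in_x [simp]: "subst_fps (fps_in_x f) F = f"
proof -
  have "fps_nth (collapse (fps_in_x f)) m = fps_nth f m" for m
  proof -
    have "(\<Sum>n\<le>m. fps_nth (fps_const (fps_nth f n)) (m - n)) = (\<Sum>n\<in>{m}. fps_nth f n)"
      by (rule sum.mono_neutral_cong_right) auto
    then show ?thesis by (simp add: collapse_def fps_in_x_def)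
  qed
  then show ?thesis by (simp add: subst_fps_collapse fps_in_x_def fps_eq_iff)
qed

lemma subst_fps_const: "subst_fps (fps_const g) F = fps_compose g F"
proof -
  have "Abs_fps (\<lambda>n. fps_compose (fps_nth (fps_const g) n) F) = fps_const (fps_compose g F) * 1"
    by (simp add: fps_eq_iff)
  moreover have "collapse 1 = (1 :: 'a fps)"
    by (subst collapse_rec) (simp add: collapse_def fps_eq_iff)
  ultimately show ?thesis unfolding subst_fps_collapse
    by (metis collapse_const_mult mult_1_right)
qed

lemma subst_y_minus: "fps_nth F 0 = 0 \<Longrightarrow> subst_fps (y_minus F') F = F - F'"
  by (simp add: y_minus_eq subst_fps_diff subst_fps_const)

lemma ramify_y_minus: "N \<ge> 1 \<Longrightarrow> ramify N (y_minus F) = y_minus (ramify N F)"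
  by (auto simp: y_minus_def ramify_diff fps_eq_iff[where ?'a="'a fps"] ramify_nth)

text \<open>Both variables of C become x under \<open>collapse\<close>, so the outer and the inner
  one must both be ramified.\<close>

lemma ramify_collapse:
  assumes "N \<ge> 1"
  shows "ramify N (collapse C)
    = collapse (Abs_fps (\<lambda>n. ramify N (fps_nth (ramify N C) n)))"
proof (rule fps_ext)
  fix m
  have "fps_nth (collapse (Abs_fps (\<lambda>n. ramify N (fps_nth (ramify N C) n)))) m
     = (\<Sum>n\<le>m. if N dvd n \<and> N dvd m - n then fps_nth (fps_nth C (n div N)) ((m - n) div N) else 0)"
    using assms by (auto simp: collapse_def ramify_nth intro!: sum.cong)
  also have "\<dots> = fps_nth (ramify N (collapse C)) m"
  proof (cases "N dvd m")
    case True
    then obtain k where m: "m = N * k" by blast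
    have "(\<Sum>n\<le>m. if N dvd n \<and> N dvd m - n then fps_nth (fps_nth C (n div N)) ((m - n) div N) else 0)
      = (\<Sum>n\<in>(\<lambda>j. N * j) ` {..k}. fps_nth (fps_nth C (n div N)) ((m - n) div N))"
    proof (rule sum.mono_neutral_cong_right)
      show "(*) N ` {..k} \<subseteq> {..m}" using assms m by auto
      show "\<forall>i\<in>{..m} - (*) N ` {..k}. (if N dvd i \<and> N dvd m - i
          then fps_nth (fps_nth C (i div N)) ((m - i) div N) else 0) = 0"
        using assms m by (auto elim!: dvdE)
      show "(if N dvd x \<and> N dvd m - x then fps_nth (fps_nth C (x div N)) ((m - x) div N) else 0)
          = fps_nth (fps_nth C (x div N)) ((m - x) div N)" if "x \<in> (*) N ` {..k}" for x
        using that True by (auto simp: dvd_diff_nat)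
    qed auto
    also have "\<dots> = (\<Sum>j\<le>k. fps_nth (fps_nth C j) (k - j))"
      using assms by (subst sum.reindex)
        (auto simp: inj_on_def m right_diff_distrib' [symmetric])
    finally show ?thesis using assms by (simp add: ramify_nth collapse_def m)
  next
    case False
    then have "\<not> (N dvd n \<and> N dvd m - n)" if "n \<le> m" for n
      using that by (metis dvd_add_right_iff le_add_diff_inverse)
    then have "(\<Sum>n\<le>m. if N dvd n \<and> N dvd m - n
        then fps_nth (fps_nth C (n div N)) ((m - n) div N) else 0) = 0"
      by (intro sum.neutral) auto
    then show ?thesis using assms False by (simp add: ramify_nth)
  qed
  finally show "fps_nth (ramify N (collapse C)) m
    = fps_nth (collapse (Abs_fps (\<lambda>n. ramify N (fps_nth (ramify N C) n)))) m" by simp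
qed

lemma ramify_subst_fps:
  fixes F :: "'a::idom fps"
  assumes N: "N \<ge> 1" and F: "fps_nth F 0 = 0"
  shows "subst_fps (ramify N G) (ramify N F) = ramify N (subst_fps G F)"
proof -
  have "fps_compose g (ramify N F) = ramify N (fps_compose g F)" for g
    unfolding ramify_def using N F by (subst fps_compose_assoc) auto
  then show ?thesis unfolding subst_fps_collapse ramify_collapse[OF N]
    by (intro arg_cong[of _ _ collapse]) (simp add: fps_eq_iff[where ?'a="'a fps"] ramify_nth[OF N])
qed

section \<open>Weierstrass division\<close>

text \<open>The coefficients of P are series in x, but x is the outer variable of the target type,
  so the two indices are exchanged.\<close>

definition fps2_of_poly :: "'a::comm_ring_1 fps poly \<Rightarrow> 'a fps fps" where
  "fps2_of_poly P = Abs_fps (\<lambda>n. Abs_fps (\<lambda>i. fps_nth (coeff P i) n))"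

lemma fps2_of_poly_pCons:
  "fps2_of_poly (pCons a p) = fps_in_x a + fps_const fps_X * fps2_of_poly p"
proof (intro fps_ext)
  fix n i
  show "fps_nth (fps_nth (fps2_of_poly (pCons a p)) n) i
    = fps_nth (fps_nth (fps_in_x a + fps_const fps_X * fps2_of_poly p) n) i"
    by (cases i) (simp_all add: fps2_of_poly_def fps_in_x_def)
qed

lemma subst_fps2_of_poly:
  fixes F :: "'a::idom fps"
  assumes "fps_nth F 0 = 0"
  shows "subst_fps (fps2_of_poly P) F = poly P F"
proof (induction P)
  case 0
  have "fps2_of_poly 0 = fps_in_x (0 :: 'a fps)"
    by (intro fps_ext) (simp add: fps2_of_poly_def fps_in_x_def)
  then show ?case by simp
next
  case (pCons a p)
  then show ?case
    using assms by (simp add: fps2_of_poly_pCons subst_fps_add subst_fps_mult subst_fps_const)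
qed

lemma ramify_fps2_of_poly:
  "N \<ge> 1 \<Longrightarrow> ramify N (fps2_of_poly P) = fps2_of_poly (map_poly (ramify N) P)"
  by (intro fps_ext) (simp add: fps2_of_poly_def ramify_nth coeff_map_poly)

lemma fps2_of_poly_nth_0: "fps_nth (fps2_of_poly P) 0 = fps_of_poly (map_poly (\<lambda>f. fps_nth f 0) P)"
  by (intro fps_ext) (simp add: fps2_of_poly_def coeff_map_poly)

text \<open>
  The coefficient of $x^n$ in $S = Q G + R$ reads
  $S_n - \sum_{i<n} Q_i G_{n-i} = Q_n G_0 + R_n$ with $G_0 = y^m \cdot \mathrm{unit}$, so $Q_n$ is obtained
  from the left side by cutting off its terms of degree less than $m$ in $y$.
\<close>

fun weierstrass_quotient :: "nat \<Rightarrow> 'a::field fps fps \<Rightarrow> 'a fps fps \<Rightarrow> nat \<Rightarrow> 'a fps" where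
  "weierstrass_quotient m G S n =
     fps_shift m (fps_nth S n - (\<Sum>i<n. weierstrass_quotient m G S i * fps_nth G (n - i)))
       * inverse (fps_shift m (fps_nth G 0))"

declare weierstrass_quotient.simps [simp del]

lemma fps_shift_mult_X_power:
  assumes "\<And>j. j < k \<Longrightarrow> fps_nth f j = 0"
  shows "fps_shift k f * fps_X ^ k = (f :: 'a::comm_ring_1 fps)"
  by (rule fps_ext) (auto simp: fps_X_power_mult_right_nth assms)

lemma weierstrass_division:
  fixes G S :: "'a::field fps fps"
  assumes "fps_nth G 0 \<noteq> 0" and m: "subdegree (fps_nth G 0) = m"
  obtains Q R where "S = Q * G + R" "\<And>n i. i \<ge> m \<Longrightarrow> fps_nth (fps_nth R n) i = 0"
proof -
  define q where "q = weierstrass_quotient m G S"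
  define s where "s n = fps_nth S n - (\<Sum>i<n. q i * fps_nth G (n - i))" for n
  define u where "u = fps_shift m (fps_nth G 0)"
  have G0: "fps_nth G 0 = u * fps_X ^ m"
    unfolding u_def using m by (subst fps_shift_mult_X_power) (auto intro: nth_less_subdegree_zero)
  have "fps_nth u 0 \<noteq> 0"
    using assms by (auto simp: u_def)
  then have u: "inverse u * u = 1" by (rule inverse_mult_eq_1)
  have q: "q n = fps_shift m (s n) * inverse u" for n
    by (simp add: q_def s_def u_def weierstrass_quotient.simps[of m G S n])
  define R where "R = S - Abs_fps q * G"
  have "fps_nth (fps_nth R n) i = 0" if "i \<ge> m" for n i
  proof -
    have "{0..n} = insert n {..<n}" by auto
    then have "fps_nth R n = s n - q n * fps_nth G 0"
      by (simp add: R_def s_def fps_mult_nth)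
    also have "q n * fps_nth G 0 = fps_shift m (s n) * fps_X ^ m * (inverse u * u)"
      unfolding q G0 by (simp only: mult_ac)
    finally show ?thesis using that by (simp add: u fps_X_power_mult_right_nth)
  qed
  then show ?thesis using that[of "Abs_fps q" R] by (simp add: R_def)
qed

text \<open>Divide y^m by G. At x = 0 both y^m and Q G are multiples of y^m, whereas R has degree
  less than m in y, so R vanishes there. Comparing orders then makes Q a unit, and W = y^m -
  R.\<close>

lemma weierstrass_preparation:
  fixes G :: "'a::field fps fps"
  assumes "fps_nth G 0 \<noteq> 0" and m: "subdegree (fps_nth G 0) = m"
  obtains Q W where "Q * G = fps2_of_poly W" "fps_nth (fps_nth Q 0) 0 \<noteq> 0"
    "degree W = m" "lead_coeff W = 1" "\<And>i. i < m \<Longrightarrow> fps_nth (coeff W i) 0 = 0"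
proof -
  obtain Q R where QR: "fps_const (fps_X ^ m) = Q * G + R"
    and R: "\<And>n i. i \<ge> m \<Longrightarrow> fps_nth (fps_nth R n) i = 0"
    using weierstrass_division[OF assms] by metis
  have 0: "fps_X ^ m = fps_nth Q 0 * fps_nth G 0 + fps_nth R 0"
    using arg_cong[OF QR, of "\<lambda>f. fps_nth f 0"] by simp
  have G0: "fps_nth G 0 = fps_shift m (fps_nth G 0) * fps_X ^ m"
    using m by (subst fps_shift_mult_X_power) (auto intro: nth_less_subdegree_zero)
  have R0: "fps_nth (fps_nth R 0) i = 0" for i
  proof (cases "i < m")
    case True
    have "fps_nth (fps_nth Q 0 * fps_nth G 0) i = 0"
      using True by (subst G0) (simp add: fps_X_power_mult_right_nth flip: mult.assoc)
    then show ?thesis using arg_cong[OF 0, of "\<lambda>f. fps_nth f i"] True by simp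
  qed (use R in auto)
  then have eq: "fps_X ^ m = fps_nth Q 0 * fps_nth G 0"
    using 0 by (metis add.right_neutral fps_ext fps_zero_nth)
  then have "fps_nth Q 0 \<noteq> 0" by auto
  then have "m = subdegree (fps_nth Q 0) + m"
    using arg_cong[OF eq, of subdegree] assms by simp
  then have Q: "fps_nth (fps_nth Q 0) 0 \<noteq> 0"
    using \<open>fps_nth Q 0 \<noteq> 0\<close> by (metis add_cancel_left_left nth_subdegree_nonzero)
  define W where "W = monom 1 m - (\<Sum>i<m. monom (Abs_fps (\<lambda>n. fps_nth (fps_nth R n) i)) i)"
  have W: "coeff W i = (if i = m then 1 else if i < m then - Abs_fps (\<lambda>n. fps_nth (fps_nth R n) i) else 0)" for i
    by (auto simp: W_def coeff_sum)
  have deg: "degree W = m"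
    by (intro antisym degree_le le_degree) (auto simp: W)
  have "Q * G = fps_const (fps_X ^ m) - R" using QR by simp
  also have "\<dots> = fps2_of_poly W"
    by (intro fps_ext) (auto simp: fps2_of_poly_def W R)
  finally show ?thesis using that[of Q W] Q deg R0 by (auto simp: W)
qed

text \<open>As F(0) = 0, the divisor is y at t = 0. So the remainder is free of y, and substituting
  F identifies it with the value of G at F.\<close>

lemma y_minus_dvd:
  fixes G :: "'a::field fps fps"
  assumes F: "fps_nth F 0 = 0" and root: "subst_fps G F = 0"
  obtains H where "G = y_minus F * H"
proof -
  have y0: "fps_nth (y_minus F) 0 = fps_X" using F by (simp add: y_minus_def)
  obtain Q R where QR: "G = Q * y_minus F + R"
    and R: "\<And>n i. i \<ge> 1 \<Longrightarrow> fps_nth (fps_nth R n) i = 0"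
    by (rule weierstrass_division[of "y_minus F" 1 G]) (auto simp: y0)
  define r where "r = Abs_fps (\<lambda>n. fps_nth (fps_nth R n) 0)"
  have Rr: "R = fps_in_x r"
    using R by (intro fps_ext) (auto simp: fps_in_x_def r_def)
  have "subst_fps G F = r"
    using F by (simp add: QR Rr subst_fps_add subst_fps_mult subst_y_minus)
  then have "R = fps_in_x 0" using root Rr by simp
  then have "R = 0" by (intro fps_ext) (simp add: fps_in_x_def)
  then show ?thesis using that[of Q] QR by (simp add: mult.commute)
qed

section \<open>The Newton--Puiseux theorem\<close>

text \<open>Needed for two coefficient maps: \<open>ramify N\<close> and evaluation at x =
  0.\<close>

lemma map_poly_pcompose:
  fixes h :: "'b::comm_ring_1 \<Rightarrow> 'c::comm_ring_1"
  assumes h0: "h 0 = 0" and add: "\<And>x y. h (x + y) = h x + h y" and mult: "\<And>x y. h (x * y) = h x * h y"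
  shows "map_poly h (pcompose p q) = pcompose (map_poly h p) (map_poly h q)"
proof -
  have hadd: "map_poly h (r + s) = map_poly h r + map_poly h s" for r s
    by (rule poly_eqI) (simp add: coeff_map_poly h0 add)
  have hmult: "map_poly h (r * s) = map_poly h r * map_poly h s" for r s
    by (induction r) (simp_all add: hadd h0 map_poly_pCons map_poly_smult mult)
  show ?thesis
    by (induction p) (simp_all add: pcompose_pCons map_poly_pCons h0 hadd hmult)
qed

lemma map_poly_ramify_pcompose:
  fixes p :: "'a::idom fps poly"
  assumes "N \<ge> 1"
  shows "map_poly (ramify N) (pcompose p q) = pcompose (map_poly (ramify N) p) (map_poly (ramify N) q)"
  by (rule map_poly_pcompose) (simp_all add: ramify_add ramify_mult[OF assms])

definition has_puiseux_root :: "'a::comm_ring_1 fps poly \<Rightarrow> bool" where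
  "has_puiseux_root P \<longleftrightarrow> (\<exists>N\<ge>1. \<exists>F. poly (map_poly (ramify N) P) F = 0)"

text \<open>A root F of the composition gives the root Q(F) of P, with Q ramified like P. The
  Tschirnhaus shift, the Newton polygon substitution and the shift by \<beta> are all undone in this
  way.\<close>

lemma has_puiseux_root_pcompose:
  fixes P :: "'a::idom fps poly"
  shows "has_puiseux_root (pcompose P Q) \<Longrightarrow> has_puiseux_root P"
  unfolding has_puiseux_root_def by (metis map_poly_ramify_pcompose poly_pcompose)

lemma has_puiseux_root_ramify:
  assumes "q \<ge> 1" "has_puiseux_root (map_poly (ramify q) P)"
  shows "has_puiseux_root P"
proof -
  obtain N F where N: "N \<ge> 1" and F: "poly (map_poly (ramify N) (map_poly (ramify q) P)) F = 0"
    using assms(2) by (auto simp: has_puiseux_root_def)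
  have "map_poly (ramify N) (map_poly (ramify q) P) = map_poly (ramify (q * N)) P"
    by (rule poly_eqI) (simp add: coeff_map_poly ramify_ramify[OF assms(1) N])
  then show ?thesis using F N assms(1) unfolding has_puiseux_root_def
    by (metis mult_le_mono nat_mult_1)
qed

text \<open>The coefficient of f at n reappears in \<open>ramify N f\<close> at N * n.\<close>

lemma ramify_eq_0_iff: "N \<ge> 1 \<Longrightarrow> ramify N f = 0 \<longleftrightarrow> f = 0"
  by (metis dvd_triv_left fps_ext fps_zero_nth nonzero_mult_div_cancel_left not_one_le_zero
      ramify_0 ramify_nth)

lemma has_puiseux_root_smult:
  fixes P :: "'a::idom fps poly"
  assumes "has_puiseux_root P"
  shows "has_puiseux_root (smult c P)"
proof -
  obtain N F where N: "N \<ge> 1" and F: "poly (map_poly (ramify N) P) F = 0"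
    using assms by (auto simp: has_puiseux_root_def)
  have "map_poly (ramify N) (smult c P) = smult (ramify N c) (map_poly (ramify N) P)"
    by (rule map_poly_smult) (simp_all add: ramify_mult[OF N])
  then have "poly (map_poly (ramify N) (smult c P)) F = 0" using F by simp
  then show ?thesis using N unfolding has_puiseux_root_def by blast
qed

lemma has_puiseux_root_if_root:
  assumes "poly P F = 0"
  shows "has_puiseux_root P"
proof -
  have "map_poly (ramify 1) P = P"
    by (rule poly_eqI) (simp add: coeff_map_poly ramify_one[unfolded One_nat_def])
  then show ?thesis using assms unfolding has_puiseux_root_def by (metis le_refl)
qed

text \<open>Every root of the Weierstrass polynomial of $G$ has constant term $0$, since modulo $x$ that
  polynomial is $y^m$.\<close>

lemma positive_root_if_puiseux_roots:
  fixes G :: "'a::field fps fps"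
  assumes G0: "fps_nth G 0 \<noteq> 0" and m: "subdegree (fps_nth G 0) = m" "m \<ge> 1"
    and roots: "\<And>W :: 'a fps poly. degree W = m \<Longrightarrow> lead_coeff W = 1 \<Longrightarrow> has_puiseux_root W"
  obtains N F where "N \<ge> 1" "fps_nth F 0 = 0" "subst_fps (ramify N G) F = 0"
proof -
  obtain Q W where QW: "Q * G = fps2_of_poly W" and Q: "fps_nth (fps_nth Q 0) 0 \<noteq> 0"
    and W: "degree W = m" "lead_coeff W = 1" "\<And>i. i < m \<Longrightarrow> fps_nth (coeff W i) 0 = 0"
    using weierstrass_preparation[OF G0 m(1)] by metis
  obtain N F where N: "N \<ge> 1" and F: "poly (map_poly (ramify N) W) F = 0"
    using roots[OF W(1,2)] by (auto simp: has_puiseux_root_def)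
  have "degree (map_poly (ramify N) W) = m"
    using N W by (subst degree_map_poly) (auto simp: ramify_eq_0_iff)
  then have "0 = fps_nth (\<Sum>i\<le>m. ramify N (coeff W i) * F ^ i) 0"
    using F by (simp add: poly_altdef coeff_map_poly)
  also have "\<dots> = (\<Sum>i\<le>m. fps_nth (coeff W i) 0 * fps_nth F 0 ^ i)"
    using N by (simp add: fps_sum_nth fps_power_zeroth)
  also have "\<dots> = (\<Sum>i\<in>{m}. fps_nth F 0 ^ i)"
    using W by (intro sum.mono_neutral_cong_right) auto
  finally have F0: "fps_nth F 0 = 0" by simp
  have "ramify N Q * ramify N G = fps2_of_poly (map_poly (ramify N) W)"
    using QW N by (metis ramify_mult ramify_fps2_of_poly)
  then have "subst_fps (ramify N Q) F * subst_fps (ramify N G) F = 0"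
    using F F0 by (metis subst_fps_mult subst_fps2_of_poly)
  moreover have "subst_fps (ramify N Q) F \<noteq> 0"
    using Q N by (metis fps_zero_nth ramify_nth_0 subst_fps_nth_0)
  ultimately show ?thesis using that N F0 by auto
qed

section \<open>The reduction step: Newton polygon, Tschirnhaus transformation, a root of smaller
  order\<close>

lemma subdegree_pcompose_shift:
  fixes p :: "'a::field poly"
  assumes "p \<noteq> 0"
  shows "subdegree (fps_of_poly (pcompose p [:\<beta>, 1:])) = order \<beta> p"
proof -
  obtain r where p: "p = [:-\<beta>, 1:] ^ order \<beta> p * r" and r: "\<not> [:-\<beta>, 1:] dvd r"
    using order_decomp[OF assms] by metis
  have "pcompose ([:-\<beta>, 1:] ^ k) [:\<beta>, 1:] = [:0, 1:] ^ k" for k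
    by (induction k) (simp_all add: pcompose_1 pcompose_mult pcompose_pCons del: mult_pCons_left)
  then have eq: "fps_of_poly (pcompose p [:\<beta>, 1:])
      = fps_X ^ order \<beta> p * fps_of_poly (pcompose r [:\<beta>, 1:])"
    by (subst p) (simp add: pcompose_mult fps_of_poly_mult fps_of_poly_power)
  have nz: "fps_nth (fps_of_poly (pcompose r [:\<beta>, 1:])) 0 \<noteq> 0"
    using r by (unfold fps_of_poly_nth coeff_pcompose_0) (simp add: poly_eq_0_iff_dvd)
  have "fps_of_poly (pcompose r [:\<beta>, 1:]) \<noteq> 0"
    using nz by (metis fps_zero_nth)
  moreover have "subdegree (fps_of_poly (pcompose r [:\<beta>, 1:])) = 0"
    using nz by (rule subdegree_eq_0)
  ultimately show ?thesis
    unfolding eq by (subst subdegree_mult) simp_all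
qed

text \<open>
  The substitution $x = t^q$, $y = t^p z$, where $p/q$ is the least of the slopes
  $\mathrm{ord}(b_i)/(m-i)$ of the coefficients $b_i$ of $y^i$: it makes $P$ divisible by $t^{pm}$,
  and the quotient is monic with a nonzero lower coefficient at $t = 0$.
\<close>

lemma newton_polygon_substitution:
  fixes P :: "'a::field fps poly"
  assumes P: "degree P = m" "lead_coeff P = 1" and nz: "\<exists>i<m. coeff P i \<noteq> 0"
  obtains p q P1 where "q \<ge> 1"
    "pcompose (map_poly (ramify q) P) (monom (fps_X ^ p) 1) = smult (fps_X ^ (p * m)) P1"
    "degree P1 = m" "lead_coeff P1 = 1" "\<And>i. coeff P i = 0 \<Longrightarrow> coeff P1 i = 0"
    "\<exists>i<m. fps_nth (coeff P1 i) 0 \<noteq> 0"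
proof -
  \<comment> \<open>Zero coefficients are left out: \<open>subdegree 0\<close> is 0, which would
    give a false slope.\<close>
  define I where "I = {i. i < m \<and> coeff P i \<noteq> 0}"
  define slope where "slope i = of_nat (subdegree (coeff P i)) / (of_nat (m - i) :: rat)" for i
  have I: "finite I" "I \<noteq> {}" using nz by (auto simp: I_def)
  then obtain i0 where i0: "i0 \<in> I" "slope i0 = Min (slope ` I)"
    by (metis (mono_tags, lifting) Min_in finite_imageI image_iff image_is_empty)
  \<comment> \<open>The minimal slope is p / q, not necessarily in lowest terms; only the ratio
    matters.\<close>
  define p where "p = subdegree (coeff P i0)"
  define q where "q = m - i0"
  have q: "q \<ge> 1" using i0 by (auto simp: q_def I_def)
  have slopes: "p * (m - i) \<le> q * subdegree (coeff P i)" if "i \<in> I" for i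
  proof -
    have "slope i0 \<le> slope i" using that I i0 by simp
    moreover have "m - i > 0" "m - i0 > 0" using that i0 by (auto simp: I_def)
    ultimately have "(of_nat (p * (m - i)) :: rat) \<le> of_nat (q * subdegree (coeff P i))"
      by (simp add: slope_def p_def q_def field_simps del: of_nat_diff)
    then show ?thesis by (simp only: of_nat_le_iff)
  qed
  \<comment> \<open>The term b_i y^i becomes b_i(t^q) t^(p i) z^i. To divide it by t^(p m), the
    power t^(p (m - i)) must divide b_i(t^q), which is what minimality of the slope gives.\<close>
  define c where "c i = fps_shift (p * (m - i)) (ramify q (coeff P i))" for i
  have c: "c i * fps_X ^ (p * (m - i)) = ramify q (coeff P i)" if "i \<le> m" for i
    unfolding c_def
  proof (rule fps_shift_mult_X_power)
    fix j assume j: "j < p * (m - i)"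
    show "fps_nth (ramify q (coeff P i)) j = 0"
    proof (cases "i \<in> I")
      case True
      have "fps_nth (coeff P i) (j div q) = 0" if "q dvd j"
      proof (rule nth_less_subdegree_zero)
        have "q * (j div q) < q * subdegree (coeff P i)"
          using slopes[OF True] j that by simp
        then show "j div q < subdegree (coeff P i)" by simp
      qed
      then show ?thesis using q by (simp add: ramify_nth)
    next
      case False
      then show ?thesis using j that by (cases "i = m") (auto simp: I_def)
    qed
  qed
  define P1 where "P1 = (\<Sum>i\<le>m. monom (c i) i)"
  have P1: "coeff P1 i = (if i \<le> m then c i else 0)" for i
    by (simp add: P1_def coeff_sum)
  have cm: "c m = 1" using P by (simp add: c_def)
  have deg: "degree P1 = m"
    by (intro antisym degree_le le_degree) (auto simp: P1 cm)
  have subst: "pcompose (map_poly (ramify q) P) (monom (fps_X ^ p) 1) = smult (fps_X ^ (p * m)) P1"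
  proof (rule poly_eqI)
    fix i
    show "coeff (pcompose (map_poly (ramify q) P) (monom (fps_X ^ p) 1)) i
      = coeff (smult (fps_X ^ (p * m)) P1) i"
    proof (cases "i \<le> m")
      case True
      then have eq: "p * m = p * (m - i) + p * i" by (simp flip: distrib_left)
      have "ramify q (coeff P i) * (fps_X ^ p) ^ i = c i * (fps_X ^ (p * (m - i)) * fps_X ^ (p * i))"
        by (simp add: power_mult[of _ p i] c[OF True] flip: mult.assoc)
      also have "\<dots> = fps_X ^ (p * m) * c i"
        unfolding eq power_add by (rule mult.commute)
      finally show ?thesis using True by (simp add: coeff_map_poly P1 mult.commute)
    next
      case False
      then show ?thesis using P by (simp add: coeff_map_poly P1 coeff_eq_0)
    qed
  qed
  \<comment> \<open>Carries the vanishing of the coefficient of y^(m-1) over to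
    \<open>P1\<close>.\<close>
  have zero: "coeff P1 i = 0" if "coeff P i = 0" for i
    using that by (simp add: P1 c_def)
  have "fps_nth (coeff P1 i0) 0 \<noteq> 0"
  proof -
    \<comment> \<open>The shift by p * (m - i0) = p * q brings the lowest nonzero coefficient of
      b_i0(t^q) to index 0.\<close>
    have "fps_nth (coeff P1 i0) 0 = fps_nth (ramify q (coeff P i0)) (p * q)"
      using i0 by (simp add: P1 c_def q_def I_def)
    also have "\<dots> = fps_nth (coeff P i0) p" using q by (simp add: ramify_nth)
    finally show ?thesis using i0 by (simp add: p_def I_def)
  qed
  moreover have "i0 < m" using i0 by (simp add: I_def)
  ultimately have nz: "\<exists>i<m. fps_nth (coeff P1 i) 0 \<noteq> 0" by blast
  have "lead_coeff P1 = 1" using deg cm by (simp add: P1)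
  from that[OF q subst deg this zero nz] show ?thesis .
qed

text \<open>Algebraic closedness gives a root \<beta>. If its order were m, then p = (y - \<beta>)^m
  with coefficient - m \<beta> = 0 at y^(m-1), so \<beta> = 0 in characteristic 0, and p = y^m
  contradicts the nonzero lower coefficient.\<close>

lemma exists_root_of_smaller_order:
  fixes p :: "'a::{alg_closed_field, field_char_0} poly"
  assumes p: "degree p = m" "lead_coeff p = 1" and m: "m \<ge> 1"
    and tschirnhaus: "coeff p (m - 1) = 0" and nz: "i < m" "coeff p i \<noteq> 0"
  obtains \<beta> where "1 \<le> order \<beta> p" "order \<beta> p < m"
proof -
  obtain \<beta> where "poly p \<beta> = 0" using alg_closed_imp_poly_has_root[of p] p m by auto
  moreover have p0: "p \<noteq> 0" using nz by auto
  ultimately have 1: "1 \<le> order \<beta> p" by (simp add: order_root Suc_le_eq)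
  have "order \<beta> p \<noteq> m"
  proof
    assume ord: "order \<beta> p = m"
    then obtain r where r: "p = [:-\<beta>, 1:] ^ m * r"
      using order_1[of \<beta> p] by (auto elim: dvdE)
    then have "r \<noteq> 0" using p0 by auto
    then have "degree p = m + degree r"
      unfolding r by (subst degree_mult_eq) (auto simp: degree_power_eq)
    then obtain a where a: "r = [:a:]" using p by (auto elim: degree_eq_zeroE)
    moreover have "lead_coeff r = 1"
      using p(2) unfolding r by (simp add: lead_coeff_mult lead_coeff_power)
    ultimately have peq: "p = [:-\<beta>, 1:] ^ m" using r by (simp add: one_pCons)
    have "coeff p (m - 1) = of_nat m * - \<beta>"
      unfolding peq using m by (simp add: coeff_linear_poly_power flip: binomial_symmetric)
    then have "\<beta> = 0" using tschirnhaus m by auto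
    then have "coeff p i = 0" using nz(1) by (simp add: peq coeff_linear_poly_power)
    with nz show False by simp
  qed
  then show ?thesis using 1 that[of \<beta>] order_degree[OF p0, of \<beta>] p by simp
qed

text \<open>Only the terms of degree m - 1 and m of P reach y^(m-1) after the shift, and the leading
  one contributes m s.\<close>

lemma tschirnhaus_transformation:
  fixes P :: "'a::idom poly"
  assumes P: "degree P = m" "lead_coeff P = 1" and m: "m \<ge> 1" and s: "of_nat m * s = - coeff P (m - 1)"
  defines "P' \<equiv> pcompose P [:s, 1:]"
  shows "degree P' = m" "lead_coeff P' = 1" "coeff P' (m - 1) = 0"
proof -
  show deg: "degree P' = m" using P by (simp add: P'_def degree_pcompose)
  show "lead_coeff P' = 1"
    using lead_coeff_comp[of "[:s, 1:]" P] P by (simp add: P'_def)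
  obtain k where k: "m = Suc k" using m by (cases m) auto
  have "degree (map_poly (\<lambda>x. [:x:]) P) = m"
    using P by (subst degree_map_poly) auto
  then have "coeff P' k = (\<Sum>i\<le>m. coeff P i * coeff ([:s, 1:] ^ i) k)"
    by (simp add: P'_def pcompose_altdef poly_altdef coeff_map_poly coeff_sum)
  also have "\<dots> = (\<Sum>i\<in>{k, Suc k}. coeff P i * coeff ([:s, 1:] ^ i) k)"
    unfolding k by (intro sum.mono_neutral_right) (auto intro: coeff_eq_0 simp: degree_linear_power)
  also have "\<dots> = coeff P k + of_nat m * s"
    using P coeff_linear_poly_power[of k "Suc k" s 1]
    by (simp add: coeff_linear_poly_power k del: power_Suc)
  also have "\<dots> = 0" using s k by simp
  finally show "coeff P' (m - 1) = 0" by (simp add: k)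
qed

text \<open>
  After the Tschirnhaus transformation and the Newton polygon substitution, the polynomial at
  $t = 0$ has a root $\beta$ of order less than $m$; Weierstrass preparation at $\beta$ then gives a
  polynomial of smaller degree.
\<close>

theorem monic_has_puiseux_root:
  fixes P :: "'a::{alg_closed_field, field_char_0} fps poly"
  assumes "degree P = m" "lead_coeff P = 1" "m \<ge> 1"
  shows "has_puiseux_root P"
  using assms
proof (induction m arbitrary: P rule: less_induct)
  case (less m)
  note m = less.prems(3)
  define s where "s = - (fps_const (1 / of_nat m) * coeff P (m - 1))"
  define P' where "P' = pcompose P [:s, 1:]"
  have "of_nat m * s = - coeff P (m - 1)"
    using m by (simp add: s_def fps_of_nat [symmetric] flip: mult.assoc)
  note P' = tschirnhaus_transformation[OF less.prems this, folded P'_def]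
  have "has_puiseux_root P'"
  proof (cases "\<exists>i<m. coeff P' i \<noteq> 0")
    \<comment> \<open>Here P' = y^m, which has no slope to choose.\<close>
    case False
    then have "poly P' 0 = 0" using m by (simp add: poly_0_coeff_0)
    then show ?thesis by (rule has_puiseux_root_if_root)
  next
    case True
    obtain p q P1 where q: "q \<ge> 1"
      and subst: "pcompose (map_poly (ramify q) P') (monom (fps_X ^ p) 1) = smult (fps_X ^ (p * m)) P1"
      and P1: "degree P1 = m" "lead_coeff P1 = 1" "\<And>i. coeff P' i = 0 \<Longrightarrow> coeff P1 i = 0"
      and nz: "\<exists>i<m. fps_nth (coeff P1 i) 0 \<noteq> 0"
      using newton_polygon_substitution[OF P'(1,2) True] by metis
    define p0 where "p0 = map_poly (\<lambda>f. fps_nth f 0) P1"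
    have deg: "degree p0 = m"
      unfolding p0_def using P1
      by (intro antisym degree_le le_degree) (auto simp: coeff_map_poly coeff_eq_0)
    then have p0: "degree p0 = m" "lead_coeff p0 = 1" "coeff p0 (m - 1) = 0"
      using P1 P'(3) by (simp_all add: p0_def coeff_map_poly)
    obtain \<beta> where \<beta>: "1 \<le> order \<beta> p0" "order \<beta> p0 < m"
      using exists_root_of_smaller_order[OF p0(1,2) m p0(3)] nz by (auto simp: p0_def coeff_map_poly)
    define P2 where "P2 = pcompose P1 [:fps_const \<beta>, 1:]"
    have "map_poly (\<lambda>f. fps_nth f 0) P2 = pcompose p0 (map_poly (\<lambda>f. fps_nth f 0) [:fps_const \<beta>, 1:])"
      unfolding P2_def p0_def by (rule map_poly_pcompose) simp_all
    then have P2_0: "fps_nth (fps2_of_poly P2) 0 = fps_of_poly (pcompose p0 [:\<beta>, 1:])"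
      by (simp add: fps2_of_poly_nth_0 map_poly_pCons)
    have "p0 \<noteq> 0" using p0(2) by auto
    \<comment> \<open>This order is the degree of the Weierstrass polynomial of \<open>P2\<close>,
      to which the induction hypothesis is applied below.\<close>
    then have ord: "subdegree (fps_nth (fps2_of_poly P2) 0) = order \<beta> p0"
      unfolding P2_0 by (rule subdegree_pcompose_shift)
    then have "fps_nth (fps2_of_poly P2) 0 \<noteq> 0" using \<beta> by auto
    then obtain N F where N: "N \<ge> 1" and F: "fps_nth F 0 = 0" "subst_fps (ramify N (fps2_of_poly P2)) F = 0"
      using positive_root_if_puiseux_roots[OF _ ord \<beta>(1)] less.IH[OF \<beta>(2)] \<beta>(1) by metis
    then have "has_puiseux_root P2" unfolding has_puiseux_root_def
      by (metis ramify_fps2_of_poly subst_fps2_of_poly)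
    then have "has_puiseux_root P1" unfolding P2_def by (rule has_puiseux_root_pcompose)
    then have "has_puiseux_root (smult (fps_X ^ (p * m)) P1)"
      by (rule has_puiseux_root_smult)
    then have "has_puiseux_root (map_poly (ramify q) P')"
      unfolding subst [symmetric] by (rule has_puiseux_root_pcompose)
    then show ?thesis using q by (rule has_puiseux_root_ramify[rotated])
  qed
  then show ?case unfolding P'_def by (rule has_puiseux_root_pcompose)
qed

section \<open>Counting positive roots\<close>

lemma fra_ps_0 [simp]: "fra_ps N F 0 = fps_nth F 0"
  by (simp add: fra_ps_def)

lemma inj_fra_ps:
  assumes "N \<ge> 1"
  shows "inj (fra_ps N)"
proof (rule injI, rule fps_ext)
  fix F G :: "'a fps" and n assume eq: "fra_ps N F = fra_ps N G"
  have "fra_ps N E (of_nat n / of_nat N) = fps_nth E n" for E :: "'a fps"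
    using assms by (simp add: fra_ps_def)
  then show "fps_nth F n = fps_nth G n" using eq by metis
qed

lemma fra_ps_ramify:
  assumes "N \<ge> 1" "M \<ge> 1"
  shows "fra_ps (N * M) (ramify M F) = fra_ps N F"
proof
  fix q :: rat
  have M: "(of_nat M :: rat) \<noteq> 0" using assms by simp
  show "fra_ps (N * M) (ramify M F) q = fra_ps N F q"
  proof (cases "q * of_nat N \<in> \<nat>")
    case True
    then obtain k where k: "q * of_nat N = of_nat k" by (auto elim: Nats_cases)
    then have "q * of_nat (N * M) = of_nat (k * M)" by (simp flip: mult.assoc)
    then show ?thesis using k assms
      by (simp only: fra_ps_def of_nat_in_Nats if_True floor_of_nat nat_int) (simp add: ramify_nth)
  next
    case False
    \<comment> \<open>q N M may be a natural number although q N is not; it is then no multiple of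
      M, and the ramified series vanishes at that index.\<close>
    have "fps_nth (ramify M F) j = 0" if j: "q * of_nat (N * M) = of_nat j" for j
    proof -
      have "\<not> M dvd j"
      proof
        assume "M dvd j"
        then obtain i where "j = M * i" by blast
        then have "of_nat M * (q * of_nat N) = of_nat M * (of_nat i :: rat)"
          using j by (simp add: mult_ac)
        then have "q * of_nat N = of_nat i" using M by simp
        then show False using False by simp
      qed
      then show ?thesis using assms by (simp add: ramify_nth)
    qed
    then have "fra_ps (N * M) (ramify M F) q = 0"
      unfolding fra_ps_def by (metis Nats_cases floor_of_nat nat_int)
    then show ?thesis using False by (simp add: fra_ps_def)
  qed
qed

section \<open>Products of linear factors times a unit\<close>

lemma y_minus_neq_0: "y_minus F \<noteq> (0 :: 'a::comm_ring_1 fps fps)"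
proof
  assume "y_minus F = (0 :: 'a fps fps)"
  then have "fps_nth (fps_nth (y_minus F) 0) 1 = 0" by simp
  then show False by (simp add: y_minus_def)
qed

text \<open>With a multiset, the multiplicity of a root is its \<open>count\<close>, and the total
  is the \<open>size\<close>.\<close>

abbreviation y_minus_prod :: "'a::comm_ring_1 fps multiset \<Rightarrow> 'a fps fps" where
  "y_minus_prod M \<equiv> prod_mset (image_mset y_minus M)"

lemma ramify_y_minus_prod:
  fixes M :: "'a::idom fps multiset"
  assumes "N \<ge> 1"
  shows "ramify N (y_minus_prod M) = y_minus_prod (image_mset (ramify N) M)"
  by (induction M) (simp_all add: ramify_mult[OF assms] ramify_y_minus[OF assms])

lemma subst_y_minus_prod:
  fixes F :: "'a::idom fps"
  assumes "fps_nth F 0 = 0"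
  shows "subst_fps (y_minus_prod M) F = (\<Prod>E\<in>#M. F - E)"
proof (induction M)
  case empty
  show ?case using subst_fps_const[of 1 F] by simp
qed (simp add: subst_fps_mult[OF assms] subst_y_minus[OF assms])

lemma subst_y_minus_prod_unit_eq_0_iff:
  fixes F :: "'a::idom fps"
  assumes "fps_nth F 0 = 0" "fps_nth (fps_nth U 0) 0 \<noteq> 0"
  shows "subst_fps (y_minus_prod M * U) F = 0 \<longleftrightarrow> F \<in># M"
proof -
  have "subst_fps U F \<noteq> 0"
    using assms(2) by (metis fps_zero_nth subst_fps_nth_0)
  then show ?thesis
    using assms by (auto simp: subst_fps_mult subst_y_minus_prod prod_mset_zero_iff)
qed

text \<open>Substituting F shows that F lies in M; cancel one factor y - F on both sides and go on
  with the smaller multiset.\<close>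

lemma y_minus_power_dvd_prod_unit:
  fixes F :: "'a::idom fps"
  assumes F: "fps_nth F 0 = 0" and U: "fps_nth (fps_nth U 0) 0 \<noteq> 0"
    and eq: "y_minus_prod M * U = y_minus F ^ k * H"
  shows "k \<le> count M F"
  using eq
proof (induction k arbitrary: M)
  case (Suc k)
  have "subst_fps (y_minus_prod M * U) F = 0"
    using F by (simp add: Suc.prems subst_fps_mult subst_y_minus)
  then have "F \<in># M" using subst_y_minus_prod_unit_eq_0_iff[OF F U] by blast
  then obtain M' where M: "M = add_mset F M'" by (metis insert_DiffM)
  then have "y_minus F * (y_minus_prod M' * U) = y_minus F * (y_minus F ^ k * H)"
    using Suc.prems by (simp add: mult_ac)
  then have "k \<le> count M' F" using Suc.IH y_minus_neq_0 mult_left_cancel by blast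
  then show ?case by (simp add: M)
qed simp

theorem puiseux_factorization:
  fixes G :: "'a::{alg_closed_field, field_char_0} fps fps"
  assumes "fps_nth G 0 \<noteq> 0"
  obtains N M U where "N \<ge> 1" "size M = subdegree (fps_nth G 0)" "\<forall>F\<in>#M. fps_nth F 0 = 0"
    "ramify N G = y_minus_prod M * U" "fps_nth (fps_nth U 0) 0 \<noteq> 0"
proof -
  have "\<exists>N\<ge>1. \<exists>M U. size M = m \<and> (\<forall>F\<in>#M. fps_nth F 0 = 0) \<and> ramify N G = y_minus_prod M * U
      \<and> fps_nth (fps_nth U 0) 0 \<noteq> 0"
    if "fps_nth G 0 \<noteq> 0" "subdegree (fps_nth G 0) = m" for m
    using that
  proof (induction m arbitrary: G)
    case 0
    then have "fps_nth (fps_nth G 0) 0 \<noteq> 0" by (metis nth_subdegree_nonzero)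
    then show ?case by (intro exI[of _ "1 :: nat"] conjI exI[of _ "{#}"] exI[of _ G])
        (simp_all add: ramify_one[unfolded One_nat_def])
  next
    case (Suc m)
    obtain N F where N: "N \<ge> 1" and F: "fps_nth F 0 = 0" "subst_fps (ramify N G) F = 0"
      using positive_root_if_puiseux_roots[OF Suc.prems(1,2) _ monic_has_puiseux_root[of _ "Suc m"]]
      by auto
    obtain H where H: "ramify N G = y_minus F * H" using y_minus_dvd[OF F] .
    \<comment> \<open>At t = 0 the factor y - F is y, so the order of H there is one less.\<close>
    have "fps_nth G 0 = fps_X * fps_nth H 0"
      using arg_cong[OF H, of "\<lambda>f. fps_nth f 0"] N F by (simp add: y_minus_def)
    then have "fps_nth H 0 \<noteq> 0" "subdegree (fps_nth H 0) = m" using Suc.prems by auto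
    from Suc.IH[OF this] obtain N' M U where N': "N' \<ge> 1" and M: "size M = m" "\<forall>F\<in>#M. fps_nth F 0 = 0"
      and U: "ramify N' H = y_minus_prod M * U" "fps_nth (fps_nth U 0) 0 \<noteq> 0" by metis
    \<comment> \<open>Splitting H may take a further denominator N', and the root F already found
      has to be ramified along with it.\<close>
    have "ramify (N * N') G = ramify N' (ramify N G)" using N N' by (simp add: ramify_ramify)
    also have "\<dots> = y_minus_prod (add_mset (ramify N' F) M) * U"
      using U(1) ramify_y_minus[OF N', of F] by (simp add: H ramify_mult[OF N'] mult.assoc)
    finally show ?case using N N' M U(2) F(1)
      by (intro exI[of _ "N * N'"] conjI exI[of _ "add_mset (ramify N' F) M"] exI[of _ U]) auto
  qed
  then show ?thesis using assms that by metis
qed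

text \<open>A root may be given with a denominator N' other than N. Both are lifted to N * N', where
  being a root means belonging to the ramified multiset.\<close>

lemma positive_roots_factored:
  fixes G :: "'a::idom fps fps"
  assumes N: "N \<ge> 1" and M: "\<forall>F\<in>#M. fps_nth F 0 = 0"
    and G: "ramify N G = y_minus_prod M * U" and U: "fps_nth (fps_nth U 0) 0 \<noteq> 0"
  shows "positive_roots G = fra_ps N ` set_mset M"
proof (intro equalityI subsetI)
  fix Y assume "Y \<in> positive_roots G"
  then obtain N' F' where N': "N' \<ge> 1" and Y: "Y = fra_ps N' F'" "fps_nth F' 0 = 0"
    and root: "subst_fps (ramify N' G) F' = 0" by (auto simp: positive_roots_def)
  have "subst_fps (ramify N (ramify N' G)) (ramify N F') = 0"
    using root Y(2) N by (simp add: ramify_subst_fps)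
  moreover have "ramify N (ramify N' G) = ramify N' (ramify N G)"
    using N N' by (simp add: ramify_ramify mult.commute)
  moreover have "\<dots> = y_minus_prod (image_mset (ramify N') M) * ramify N' U"
    using N' by (simp add: G ramify_mult ramify_y_minus_prod del: image_mset.compositionality)
  ultimately have "ramify N F' \<in># image_mset (ramify N') M"
    using U Y(2) N N' subst_y_minus_prod_unit_eq_0_iff[of "ramify N F'" "ramify N' U"] by simp
  then obtain F where F: "F \<in># M" "ramify N F' = ramify N' F" by auto
  then have "Y = fra_ps N F"
    using Y(1) N N' fra_ps_ramify[of N N' F] fra_ps_ramify[of N' N F'] by (simp add: mult.commute)
  then show "Y \<in> fra_ps N ` set_mset M" using F by blast
next
  fix Y assume "Y \<in> fra_ps N ` set_mset M"
  then obtain F where F: "F \<in># M" "Y = fra_ps N F" by blast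
  then have "subst_fps (ramify N G) F = 0"
    using subst_y_minus_prod_unit_eq_0_iff[OF _ U] M by (simp add: G)
  then show "Y \<in> positive_roots G"
    using F N M by (auto simp: positive_roots_def fra_set_def)
qed

lemma positive_root_mult_factored:
  fixes G :: "'a::idom fps fps"
  assumes N: "N \<ge> 1" and G: "ramify N G = y_minus_prod M * U"
    and U: "fps_nth (fps_nth U 0) 0 \<noteq> 0" and F: "fps_nth F 0 = 0"
  shows "positive_root_mult G (fra_ps N F) = enat (count M F)"
  unfolding positive_root_mult_def
proof (rule antisym[OF Sup_least Sup_upper])
  fix x assume "x \<in> {enat k |k. \<exists>N'\<ge>1. \<exists>F' H. fra_ps N F = fra_ps N' F' \<and> ramify N' G = y_minus F' ^ k * H}"
  then obtain k N' F' H where x: "x = enat k" and N': "N' \<ge> 1" and F': "fra_ps N F = fra_ps N' F'"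
    and dvd: "ramify N' G = y_minus F' ^ k * H" by blast
  \<comment> \<open>At the common denominator N * N' the series that represents the root is
    unique.\<close>
  have "fra_ps (N * N') (ramify N F') = fra_ps (N * N') (ramify N' F)"
    using F' N N' fra_ps_ramify[of N N' F] fra_ps_ramify[of N' N F'] by (simp add: mult.commute)
  then have FF': "ramify N F' = ramify N' F"
    using N N' injD[OF inj_fra_ps[of "N * N'"]] by (metis mult_le_mono nat_mult_1)
  \<comment> \<open>If \<open>ramify N'\<close> merged elements of M, the count of F could
    grow.\<close>
  have inj: "inj (ramify N' :: 'a fps \<Rightarrow> _)"
  proof (rule injI)
    fix f g :: "'a fps" assume "ramify N' f = ramify N' g"
    then show "f = g" using N' ramify_eq_0_iff[OF N', of "f - g"] by (simp add: ramify_diff)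
  qed
  have pow: "ramify N (f ^ k) = ramify N f ^ k" for f :: "'a fps fps"
    using N by (induction k) (simp_all add: ramify_mult)
  have "y_minus_prod (image_mset (ramify N') M) * ramify N' U = ramify N' (ramify N G)"
    using N' by (simp add: G ramify_mult ramify_y_minus_prod del: image_mset.compositionality)
  also have "\<dots> = ramify N (ramify N' G)"
    using N N' by (simp add: ramify_ramify mult.commute)
  also have "\<dots> = y_minus (ramify N' F) ^ k * ramify N H"
    using N FF' by (simp add: dvd ramify_mult pow ramify_y_minus)
  finally have "k \<le> count (image_mset (ramify N') M) (ramify N' F)"
    using F U N' by (intro y_minus_power_dvd_prod_unit) auto
  also have "\<dots> = count M F"
  proof -
    have "{E. E \<in># M \<and> ramify N' F = ramify N' E} = (if F \<in># M then {F} else {})"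
      using injD[OF inj] by auto
    then show ?thesis by (simp add: count_image_mset' not_in_iff)
  qed
  finally show "x \<le> enat (count M F)" by (simp add: x)
next
  \<comment> \<open>The bound is attained: all copies of F form one power, and the other factors
    join the cofactor.\<close>
  have "M = replicate_mset (count M F) F + filter_mset (\<lambda>E. E \<noteq> F) M"
    by (rule multiset_eqI) auto
  from arg_cong[OF this, of y_minus_prod]
  have "y_minus_prod M = y_minus F ^ count M F * y_minus_prod (filter_mset (\<lambda>E. E \<noteq> F) M)"
    by simp
  then have "ramify N G = y_minus F ^ count M F * (y_minus_prod (filter_mset (\<lambda>E. E \<noteq> F) M) * U)"
    by (simp only: G mult.assoc)
  then show "enat (count M F) \<in> {enat k |k. \<exists>N'\<ge>1. \<exists>F' H. fra_ps N F = fra_ps N' F' \<and>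
      ramify N' G = y_minus F' ^ k * H}"
    using N by blast
qed

theorem sum_positive_root_mult:
  fixes G :: "'a::{alg_closed_field, field_char_0} fps fps"
  assumes "fps_nth G 0 \<noteq> 0"
  shows "finite (positive_roots G)"
    and "(\<Sum>Y\<in>positive_roots G. positive_root_mult G Y) = enat (subdegree (fps_nth G 0))"
proof -
  obtain N M U where N: "N \<ge> 1" and size: "size M = subdegree (fps_nth G 0)"
    and M: "\<forall>F\<in>#M. fps_nth F 0 = 0"
    and G: "ramify N G = y_minus_prod M * U" and U: "fps_nth (fps_nth U 0) 0 \<noteq> 0"
    by (rule puiseux_factorization[OF assms])
  note roots = positive_roots_factored[OF N M G U]
  then show "finite (positive_roots G)" by simp
  have "(\<Sum>Y\<in>positive_roots G. positive_root_mult G Y)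
      = (\<Sum>F\<in>set_mset M. positive_root_mult G (fra_ps N F))"
    unfolding roots by (subst sum.reindex) (auto intro: inj_on_subset[OF inj_fra_ps[OF N]])
  also have "\<dots> = (\<Sum>F\<in>set_mset M. of_nat (count M F))"
    using M by (intro sum.cong) (simp_all add: positive_root_mult_factored[OF N G U] of_nat_eq_enat)
  also have "\<dots> = enat (size M)"
    by (simp add: size_multiset_overloaded_eq flip: of_nat_sum of_nat_eq_enat)
  finally show "(\<Sum>Y\<in>positive_roots G. positive_root_mult G Y) = enat (subdegree (fps_nth G 0))"
    by (simp add: size)
qed

section \<open>Roots with a given constant term\<close>

text \<open>F - \<alpha> has zero constant term, so composition with it is a ring homomorphism, and
  it sends y + \<alpha> to F.\<close>

lemma fps_compose_shifted_poly:
  fixes F :: "'a::idom fps"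
  assumes "fps_nth F 0 = \<alpha>"
  shows "fps_compose (fps_of_poly (pcompose p [:\<alpha>, 1:])) (F - fps_const \<alpha>) = poly (map_poly fps_const p) F"
proof (induction p)
  case (pCons a p)
  have eq: "fps_of_poly [:\<alpha>, 1:] = fps_const \<alpha> + fps_X"
    by (rule fps_ext) (simp add: coeff_pCons split: nat.split)
  have "fps_compose (fps_of_poly [:\<alpha>, 1:]) (F - fps_const \<alpha>)
      = fps_compose (fps_const \<alpha>) (F - fps_const \<alpha>) + fps_compose fps_X (F - fps_const \<alpha>)"
    unfolding eq by (rule fps_compose_add_distrib)
  also have "\<dots> = F"
    using assms by simp
  finally show ?case
    using pCons assms by (simp add: pcompose_pCons fps_of_poly_add fps_of_poly_mult fps_of_poly_const
        fps_compose_add_distrib fps_compose_mult_distrib map_poly_pCons del: mult_pCons_left)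
qed simp

lemma subst_fps_shift_y:
  fixes F :: "'a::idom fps"
  assumes "fps_nth F 0 = \<alpha>"
  shows "subst_fps (shift_y \<alpha> H) (F - fps_const \<alpha>) = subst_poly H F"
  by (simp add: subst_fps_collapse subst_poly_collapse shift_y_def fps_compose_shifted_poly[OF assms])

lemma shift_y_ramify: "N \<ge> 1 \<Longrightarrow> shift_y \<alpha> (ramify N G) = ramify N (shift_y \<alpha> G)"
  by (rule fps_ext) (simp add: shift_y_def ramify_nth)

lemma fra_ps_diff_const:
  fixes F :: "'a::comm_ring_1 fps"
  assumes "N \<ge> 1"
  shows "fra_ps N (F - fps_const \<alpha>) = (\<lambda>q. fra_ps N F q - (if q = 0 then \<alpha> else 0))"
proof
  fix q :: rat
  show "fra_ps N (F - fps_const \<alpha>) q = fra_ps N F q - (if q = 0 then \<alpha> else 0)"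
    using assms by (auto simp: fra_ps_def elim!: Nats_cases)
qed

lemma positive_roots_shift_y:
  fixes G :: "'a::idom poly fps"
  shows "positive_roots (shift_y \<alpha> G)
    = (\<lambda>Y q. Y q - (if q = 0 then \<alpha> else 0)) ` roots_with_constant \<alpha> G" (is "_ = ?shift ` _")
proof (intro equalityI subsetI)
  fix Z assume "Z \<in> positive_roots (shift_y \<alpha> G)"
  then obtain N F where N: "N \<ge> 1" and Z: "Z = fra_ps N F" "fps_nth F 0 = 0"
    and root: "subst_fps (ramify N (shift_y \<alpha> G)) F = 0" by (auto simp: positive_roots_def)
  have "subst_poly (ramify N G) (F + fps_const \<alpha>) = 0"
    using subst_fps_shift_y[of "F + fps_const \<alpha>" \<alpha> "ramify N G"] root Z
    by (simp add: shift_y_ramify[OF N])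
  then have "fra_ps N (F + fps_const \<alpha>) \<in> roots_with_constant \<alpha> G"
    using N Z by (auto simp: roots_with_constant_def fra_set_def)
  moreover have "Z = ?shift (fra_ps N (F + fps_const \<alpha>))"
    using fra_ps_diff_const[OF N, of "F + fps_const \<alpha>" \<alpha>] Z by simp
  ultimately show "Z \<in> ?shift ` roots_with_constant \<alpha> G" by blast
next
  fix Z assume "Z \<in> ?shift ` roots_with_constant \<alpha> G"
  then obtain N F where N: "N \<ge> 1" and Z: "Z = ?shift (fra_ps N F)" "fps_nth F 0 = \<alpha>"
    and root: "subst_poly (ramify N G) F = 0" by (auto simp: roots_with_constant_def)
  have "subst_fps (ramify N (shift_y \<alpha> G)) (F - fps_const \<alpha>) = 0"
    using subst_fps_shift_y[OF Z(2), of "ramify N G"] root by (simp add: shift_y_ramify[OF N])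
  moreover have "Z = fra_ps N (F - fps_const \<alpha>)" using Z(1) fra_ps_diff_const[OF N, of F \<alpha>] by simp
  ultimately show "Z \<in> positive_roots (shift_y \<alpha> G)"
    using N Z(2) by (auto simp: positive_roots_def fra_set_def)
qed

theorem sum_root_mult:
  fixes G :: "'a::{alg_closed_field, field_char_0} poly fps"
  assumes "fps_nth G 0 \<noteq> 0"
  shows "finite (roots_with_constant \<alpha> G)"
    and "(\<Sum>Y\<in>roots_with_constant \<alpha> G. root_mult G Y) = enat (order \<alpha> (fps_nth G 0))"
proof -
  let ?shift = "\<lambda>(Y :: rat \<Rightarrow> 'a) q. Y q - (if q = 0 then \<alpha> else 0)"
  have inj: "inj_on ?shift A" for A
  proof (rule inj_onI, rule ext)
    fix Y Z q assume "?shift Y = ?shift Z"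
    from fun_cong[OF this, of q] show "Y q = Z q" by simp
  qed
  have shift_0: "fps_nth (shift_y \<alpha> G) 0 = fps_of_poly (pcompose (fps_nth G 0) [:\<alpha>, 1:])"
    by (simp add: shift_y_def)
  have "fps_nth (shift_y \<alpha> G) 0 \<noteq> 0"
    using assms pcompose_eq_0[of "fps_nth G 0" "[:\<alpha>, 1:]"] fps_of_poly_eq_iff[of _ 0]
    by (auto simp: shift_0)
  note roots = sum_positive_root_mult[OF this, unfolded positive_roots_shift_y]
  show "finite (roots_with_constant \<alpha> G)"
    using roots(1) inj by (rule finite_imageD)
  \<comment> \<open>\<open>root_mult\<close> shifts by \<open>Y 0\<close>, which is \<alpha> on the
    whole index set.\<close>
  have "(\<Sum>Y\<in>roots_with_constant \<alpha> G. root_mult G Y)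
      = (\<Sum>Y\<in>roots_with_constant \<alpha> G. positive_root_mult (shift_y \<alpha> G) (?shift Y))"
    by (rule sum.cong) (auto simp: root_mult_def roots_with_constant_def)
  also have "\<dots> = enat (order \<alpha> (fps_nth G 0))"
    using roots(2) assms by (simp add: sum.reindex[OF inj] shift_0 subdegree_pcompose_shift)
  finally show "(\<Sum>Y\<in>roots_with_constant \<alpha> G. root_mult G Y) = enat (order \<alpha> (fps_nth G 0))" .
qed

theorem mainTheorem11:
  shows "(\<forall>G :: 'a::{alg_closed_field, field_char_0} fps fps.
            fps_nth G 0 \<noteq> 0 \<longrightarrow>
              finite (positive_roots G) \<and>
              (\<Sum>Y\<in>positive_roots G. positive_root_mult G Y) = enat (subdegree (fps_nth G 0))) \<and>
         (\<forall>(G :: 'a poly fps) \<alpha>.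
            fps_nth G 0 \<noteq> 0 \<longrightarrow>
              finite (roots_with_constant \<alpha> G) \<and>
              (\<Sum>Y\<in>roots_with_constant \<alpha> G. root_mult G Y) = enat (order \<alpha> (fps_nth G 0)))"
  using sum_positive_root_mult sum_root_mult by blast

end
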